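(* If $(U_\alpha)_{\alpha\in A}$ is a filtration of a metric space $X$ such that each $U_\alpha$ (with the restricted metric) is diagonal, then $X$ is diagonal.
   Context: Metric spaces have a finite, symmetric, non-degenerate distance satisfying the triangle inequality. A point $z$ is between $x$ and $y$ if $d(x,y)=d(x,z)+d(z,y)$, strictly between if moreover $z\neq x,y$; $]x,y[$ is the set of points strictly between $x$ and $y$. A $k$-path ($k\ge0$) in $X$ is a sequence $\langle x_0,\dots,x_k\rangle$ of points of $X$ with $x_i\ne x_{i+1}$ for $0\le i<k$; it is saturated if each $]x_i,x_{i+1}[$ is empty. Magnitude complex: $\mathrm{MC}_k(X)$ is the free abelian group on the $k$-paths of $X$, with boundary $\partial_k=\sum_{i=1}^{k-1}(-1)^i\partial_{k,i}$, where $\partial_{k,i}\langle x_0,\dots,x_k\rangle=\langle x_0,\dots,\widehat{x_i},\dots,x_k\rangle$ if $x_i$ is between $x_{i-1}$ and $x_{i+1}$, and $0$ otherwise. $\mathrm{MH}_*(X)$ is its homology. $X$ is diagonal if for every $k$, $\mathrm{MH}_k(X)$ is generated by classes of cycles that are integral linear combinations of saturated $k$-paths of $X$. A filtration of $X$ is a family $(U_\alpha)_{\alpha\in A}$ of subsets indexed by a directed set $A$ with $\bigcup_\alpha U_\alpha=X$ and $U_\alpha\subseteq U_\beta$ whenever $\alpha\le\beta$. *)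

theory Defs
  imports "HOL-Analysis.Abstract_Metric_Spaces" "HOL-Algebra.Free_Abelian_Groups"
begin

text \<open>
  A metric space is given as a carrier \<open>X\<close> together with a distance \<open>d\<close>
  (\<^locale>\<open>Metric_space\<close>); a subset \<open>U\<close> of \<open>X\<close> with the restricted metric is then given by
  \<open>U\<close> and the same \<open>d\<close>.
\<close>

definition is_between :: "('a \<Rightarrow> 'a \<Rightarrow> real) \<Rightarrow> 'a \<Rightarrow> 'a \<Rightarrow> 'a \<Rightarrow> bool"
  where "is_between d x y z \<longleftrightarrow> d x y = d x z + d z y"

definition strictly_between :: "'a set \<Rightarrow> ('a \<Rightarrow> 'a \<Rightarrow> real) \<Rightarrow> 'a \<Rightarrow> 'a \<Rightarrow> 'a set"
  where "strictly_between X d x y = {z \<in> X. is_between d x y z \<and> z \<noteq> x \<and> z \<noteq> y}"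

text \<open>A \<open>k\<close>-path is a list of \<open>k + 1\<close> points.\<close>

definition paths :: "'a set \<Rightarrow> nat \<Rightarrow> 'a list set"
  where "paths X k = {xs. length xs = Suc k \<and> set xs \<subseteq> X \<and> (\<forall>i<k. xs ! i \<noteq> xs ! Suc i)}"

text \<open>Saturation is relative to \<open>X\<close>: only points of \<open>X\<close> count as intermediate points.\<close>

definition saturated_paths :: "'a set \<Rightarrow> ('a \<Rightarrow> 'a \<Rightarrow> real) \<Rightarrow> nat \<Rightarrow> 'a list set"
  where "saturated_paths X d k =
    {xs \<in> paths X k. \<forall>i<k. strictly_between X d (xs ! i) (xs ! Suc i) = {}}"

definition MC :: "'a set \<Rightarrow> nat \<Rightarrow> ('a list \<Rightarrow>\<^sub>0 int) monoid"
  where "MC X k = free_Abelian_group (paths X k)"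

definition delete_nth :: "nat \<Rightarrow> 'a list \<Rightarrow> 'a list"
  where "delete_nth i xs = take i xs @ drop (Suc i) xs"

definition face :: "('a \<Rightarrow> 'a \<Rightarrow> real) \<Rightarrow> nat \<Rightarrow> 'a list \<Rightarrow> ('a list \<Rightarrow>\<^sub>0 int)"
  where "face d i xs =
    (if is_between d (xs ! (i - 1)) (xs ! (i + 1)) (xs ! i) then frag_of (delete_nth i xs) else 0)"

text \<open>
  The boundary of \<open>MC X k\<close>. For \<open>k \<le> 1\<close> the sum is empty, so the
  boundary vanishes there.
\<close>

definition boundary :: "('a \<Rightarrow> 'a \<Rightarrow> real) \<Rightarrow> nat \<Rightarrow> ('a list \<Rightarrow>\<^sub>0 int) \<Rightarrow> ('a list \<Rightarrow>\<^sub>0 int)"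
  where "boundary d k = frag_extend (\<lambda>xs. \<Sum>i = 1..k - 1. frag_cmul ((-1) ^ i) (face d i xs))"

definition cycles :: "'a set \<Rightarrow> ('a \<Rightarrow> 'a \<Rightarrow> real) \<Rightarrow> nat \<Rightarrow> ('a list \<Rightarrow>\<^sub>0 int) set"
  where "cycles X d k = {c \<in> carrier (MC X k). boundary d k c = 0}"

definition boundaries :: "'a set \<Rightarrow> ('a \<Rightarrow> 'a \<Rightarrow> real) \<Rightarrow> nat \<Rightarrow> ('a list \<Rightarrow>\<^sub>0 int) set"
  where "boundaries X d k = boundary d (Suc k) ` carrier (MC X (Suc k))"

definition cycle_group :: "'a set \<Rightarrow> ('a \<Rightarrow> 'a \<Rightarrow> real) \<Rightarrow> nat \<Rightarrow> ('a list \<Rightarrow>\<^sub>0 int) monoid"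
  where "cycle_group X d k = subgroup_generated (MC X k) (cycles X d k)"

definition MH :: "'a set \<Rightarrow> ('a \<Rightarrow> 'a \<Rightarrow> real) \<Rightarrow> nat \<Rightarrow> ('a list \<Rightarrow>\<^sub>0 int) set monoid"
  where "MH X d k = cycle_group X d k Mod boundaries X d k"

definition homology_class ::
    "'a set \<Rightarrow> ('a \<Rightarrow> 'a \<Rightarrow> real) \<Rightarrow> nat \<Rightarrow> ('a list \<Rightarrow>\<^sub>0 int) \<Rightarrow> ('a list \<Rightarrow>\<^sub>0 int) set"
  where "homology_class X d k c = boundaries X d k #>\<^bsub>cycle_group X d k\<^esub> c"

definition diagonal :: "'a set \<Rightarrow> ('a \<Rightarrow> 'a \<Rightarrow> real) \<Rightarrow> bool"
  where "diagonal X d \<longleftrightarrow>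
    (\<forall>k. generate (MH X d k)
           (homology_class X d k `
             {c \<in> cycles X d k. Poly_Mapping.keys c \<subseteq> saturated_paths X d k})
         = carrier (MH X d k))"

text \<open>The order of the index set \<open>A\<close> is the set \<open>r\<close> of pairs \<open>(\<alpha>, \<beta>)\<close> with \<open>\<alpha> \<le> \<beta>\<close>.\<close>

definition directed_set :: "'i set \<Rightarrow> ('i \<times> 'i) set \<Rightarrow> bool"
  where "directed_set A r \<longleftrightarrow> preorder_on A r \<and> A \<noteq> {} \<and>
    (\<forall>\<alpha>\<in>A. \<forall>\<beta>\<in>A. \<exists>\<gamma>\<in>A. (\<alpha>, \<gamma>) \<in> r \<and> (\<beta>, \<gamma>) \<in> r)"

definition filtration :: "'a set \<Rightarrow> 'i set \<Rightarrow> ('i \<times> 'i) set \<Rightarrow> ('i \<Rightarrow> 'a set) \<Rightarrow> bool"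
  where "filtration X A r U \<longleftrightarrow> directed_set A r \<and> (\<Union>\<alpha>\<in>A. U \<alpha>) = X \<and>
    (\<forall>\<alpha>\<in>A. \<forall>\<beta>\<in>A. (\<alpha>, \<beta>) \<in> r \<longrightarrow> U \<alpha> \<subseteq> U \<beta>)"

end

theory Submission
  imports Defs
begin

text \<open>
  A boundary never involves a saturated path: if \<open>x\<^sub>i\<close> is between its neighbours, then the step
  from \<open>x\<^bsub>i-1\<^esub>\<close> to \<open>x\<^bsub>i+1\<^esub>\<close> created by deleting \<open>x\<^sub>i\<close> has \<open>x\<^sub>i\<close> strictly inside it. Therefore
  the projection \<open>p\<close> of chains onto saturated paths annihilates boundaries while fixing the chains
  that are already saturated. If a cycle \<open>c\<close> is homologous to a saturated chain \<open>c'\<close>, applying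
  \<open>p\<close> to \<open>c - c'\<close> yields \<open>p c = c'\<close>. So in a diagonal space every cycle \<open>c\<close> is
  homologous to one explicit chain, its own saturated part \<open>p c\<close>
  (\<open>saturated_part_homologous\<close>).

  This makes diagonality pass to the union of a filtration, even though a path that is saturated in
  some \<open>U\<^sub>\<alpha>\<close> need not be saturated in \<open>X\<close>. A cycle \<open>c\<close> of \<open>X\<close> involves only finitely many paths.
  Choose one intermediate point for each path of \<open>c\<close> that is not saturated in \<open>X\<close>; the points
  of the paths of \<open>c\<close> together with the chosen ones form a finite set, which lies in a single
  \<open>U\<^sub>\<alpha>\<close> because the index set is directed. Then \<open>c\<close> is a cycle of \<open>U\<^sub>\<alpha>\<close>, and its saturated
  parts in \<open>U\<^sub>\<alpha>\<close> and in \<open>X\<close> coincide. As \<open>U\<^sub>\<alpha>\<close> is diagonal, this common part is homologous to \<open>c\<close>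
  in \<open>U\<^sub>\<alpha>\<close>, hence in \<open>X\<close>.
\<close>

section \<open>Diagonality in terms of chains\<close>

lemma carrier_MC: "c \<in> carrier (MC X k) \<longleftrightarrow> Poly_Mapping.keys c \<subseteq> paths X k"
  by (simp add: MC_def)

lemma cycles_iff:
  "c \<in> cycles X d k \<longleftrightarrow> Poly_Mapping.keys c \<subseteq> paths X k \<and> boundary d k c = 0"
  by (simp add: cycles_def carrier_MC)

lemma boundary_0 [simp]: "boundary d k 0 = 0"
  by (simp add: boundary_def)

lemma boundary_add: "boundary d k (a + b) = boundary d k a + boundary d k b"
  by (simp add: boundary_def frag_extend_add)

lemma boundary_minus: "boundary d k (- a) = - boundary d k a"
  by (simp add: boundary_def frag_extend_minus)

lemma paths_mono: "U \<subseteq> X \<Longrightarrow> paths U k \<subseteq> paths X k"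
  by (auto simp: paths_def)

lemma boundaries_mono: "U \<subseteq> X \<Longrightarrow> boundaries U d k \<subseteq> boundaries X d k"
  using paths_mono[of U X "Suc k"] by (auto simp: boundaries_def carrier_MC)

lemma boundaries_0: "0 \<in> boundaries X d k"
  unfolding boundaries_def by (rule image_eqI[of _ _ 0]) (simp_all add: carrier_MC)

lemma boundaries_add:
  assumes "a \<in> boundaries X d k" "b \<in> boundaries X d k"
  shows "a + b \<in> boundaries X d k"
proof -
  obtain a' b' where "a = boundary d (Suc k) a'" "Poly_Mapping.keys a' \<subseteq> paths X (Suc k)"
    and "b = boundary d (Suc k) b'" "Poly_Mapping.keys b' \<subseteq> paths X (Suc k)"
    using assms by (auto simp: boundaries_def carrier_MC)
  then have "a + b = boundary d (Suc k) (a' + b')"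
    and "Poly_Mapping.keys (a' + b') \<subseteq> paths X (Suc k)"
    using keys_add[of a' b'] by (auto simp: boundary_add)
  then show ?thesis
    by (auto simp: boundaries_def carrier_MC)
qed

lemma boundaries_minus:
  assumes "a \<in> boundaries X d k"
  shows "- a \<in> boundaries X d k"
proof -
  obtain a' where "a = boundary d (Suc k) a'" "Poly_Mapping.keys a' \<subseteq> paths X (Suc k)"
    using assms by (auto simp: boundaries_def carrier_MC)
  then have "- a = boundary d (Suc k) (- a')" "Poly_Mapping.keys (- a') \<subseteq> paths X (Suc k)"
    by (auto simp: boundary_minus)
  then show ?thesis
    by (auto simp: boundaries_def carrier_MC)
qed

lemma subgroup_cycles_supported:
  "subgroup {c \<in> cycles X d k. Poly_Mapping.keys c \<subseteq> S} (MC X k)"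
proof (rule group.subgroupI)
  show "group (MC X k)"
    by (simp add: MC_def)
  show "{c \<in> cycles X d k. Poly_Mapping.keys c \<subseteq> S} \<noteq> {}"
    by (rule ex_in_conv[THEN iffD1], rule exI[of _ 0]) (simp add: cycles_iff)
  show "a \<otimes>\<^bsub>MC X k\<^esub> b \<in> {c \<in> cycles X d k. Poly_Mapping.keys c \<subseteq> S}"
    if "a \<in> {c \<in> cycles X d k. Poly_Mapping.keys c \<subseteq> S}"
      and "b \<in> {c \<in> cycles X d k. Poly_Mapping.keys c \<subseteq> S}" for a b
    using that keys_add[of a b] by (auto simp: cycles_iff MC_def boundary_add)
qed (auto simp: cycles_iff carrier_MC MC_def boundary_minus)

lemma carrier_cycle_group: "carrier (cycle_group X d k) = cycles X d k"
  using subgroup.carrier_subgroup_generated_subgroup[OF subgroup_cycles_supported[of X d k UNIV]]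
  by (simp add: cycle_group_def)

lemma subgroup_cycle_group_supported:
  "subgroup {c \<in> cycles X d k. Poly_Mapping.keys c \<subseteq> S} (cycle_group X d k)"
  unfolding cycle_group_def
  by (rule group.subgroup_of_subgroup_generated)
     (auto simp: MC_def intro: subgroup_cycles_supported[unfolded MC_def])

lemma homology_class_eq: "homology_class X d k c = (\<lambda>b. b + c) ` boundaries X d k"
  by (auto simp: homology_class_def r_coset_def cycle_group_def MC_def)

lemma homology_class_eq_iff:
  "homology_class X d k c = homology_class X d k c' \<longleftrightarrow> c - c' \<in> boundaries X d k"
proof
  assume "homology_class X d k c = homology_class X d k c'"
  moreover have "c \<in> homology_class X d k c"
    unfolding homology_class_eq by (rule image_eqI[of _ _ 0]) (simp_all add: boundaries_0)
  ultimately obtain b where "b \<in> boundaries X d k" "c = b + c'"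
    by (auto simp: homology_class_eq)
  then show "c - c' \<in> boundaries X d k"
    by simp
next
  have sub: "homology_class X d k x \<subseteq> homology_class X d k y" if "x - y \<in> boundaries X d k" for x y
  proof
    fix z assume "z \<in> homology_class X d k x"
    then obtain b where b: "b \<in> boundaries X d k" "z = b + x"
      by (auto simp: homology_class_eq)
    have "z = (b + (x - y)) + y"
      using b by simp
    then show "z \<in> homology_class X d k y"
      unfolding homology_class_eq using boundaries_add[OF b(1) that] by (rule image_eqI)
  qed
  assume "c - c' \<in> boundaries X d k"
  then show "homology_class X d k c = homology_class X d k c'"
    using sub[of c c'] sub[of c' c] boundaries_minus[of "c - c'" X d k] by auto
qed

lemma carrier_MH: "carrier (MH X d k) = homology_class X d k ` cycles X d k"
  by (auto simp: MH_def FactGroup_def RCOSETS_def homology_class_def carrier_cycle_group)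

lemma homology_class_add:
  "homology_class X d k (a + b) = homology_class X d k a \<otimes>\<^bsub>MH X d k\<^esub> homology_class X d k b"
proof -
  have mult: "A \<otimes>\<^bsub>MH X d k\<^esub> B = (\<Union>x\<in>A. \<Union>y\<in>B. {x + y})" for A B
    by (simp add: MH_def FactGroup_def set_mult_def cycle_group_def MC_def)
  show ?thesis
    unfolding mult
  proof (intro Set.set_eqI iffI)
    fix z assume "z \<in> homology_class X d k (a + b)"
    then obtain u where u: "u \<in> boundaries X d k" "z = u + (a + b)"
      by (auto simp: homology_class_eq)
    have "u + a \<in> homology_class X d k a"
      using u by (auto simp: homology_class_eq)
    moreover have "b \<in> homology_class X d k b"
      unfolding homology_class_eq by (rule image_eqI[of _ _ 0]) (simp_all add: boundaries_0)
    moreover have "z = (u + a) + b"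
      using u by (simp add: add.assoc)
    ultimately show "z \<in> (\<Union>x\<in>homology_class X d k a. \<Union>y\<in>homology_class X d k b. {x + y})"
      by blast
  next
    fix z assume "z \<in> (\<Union>x\<in>homology_class X d k a. \<Union>y\<in>homology_class X d k b. {x + y})"
    then obtain u v where uv: "u \<in> boundaries X d k" "v \<in> boundaries X d k"
      and "z = (u + a) + (v + b)"
      by (auto simp: homology_class_eq)
    then have "z = (u + v) + (a + b)"
      by (simp add: algebra_simps)
    then show "z \<in> homology_class X d k (a + b)"
      unfolding homology_class_eq using boundaries_add[OF uv] by (rule image_eqI)
  qed
qed

lemma group_hom_homology_class:
  "group_hom (cycle_group X d k) (MH X d k) (homology_class X d k)"
proof -
  have Z: "group (cycle_group X d k)"
    unfolding cycle_group_def MC_def by (simp add: group.group_subgroup_generated)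
  have hom: "homology_class X d k \<in> hom (cycle_group X d k) (MH X d k)"
  proof (rule homI)
    fix a b
    show "homology_class X d k (a \<otimes>\<^bsub>cycle_group X d k\<^esub> b) =
        homology_class X d k a \<otimes>\<^bsub>MH X d k\<^esub> homology_class X d k b"
      by (simp add: homology_class_add[symmetric] cycle_group_def MC_def)
  qed (simp add: carrier_cycle_group carrier_MH)
  \<comment> \<open>\<open>MH\<close> is the image of the group of cycles under a multiplicative map, so it inherits
    the group laws.\<close>
  have one: "\<one>\<^bsub>MH X d k\<^esub> = homology_class X d k \<one>\<^bsub>cycle_group X d k\<^esub>"
    by (simp add: MH_def FactGroup_def homology_class_eq cycle_group_def MC_def)
  have "group (MH X d k \<lparr>carrier := homology_class X d k ` carrier (cycle_group X d k),
      one := homology_class X d k \<one>\<^bsub>cycle_group X d k\<^esub>\<rparr>)"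
    using group.hom_imp_img_group[OF Z hom] .
  then have "group (MH X d k)"
    unfolding carrier_cycle_group carrier_MH[symmetric] one[symmetric] by simp
  with Z hom show ?thesis
    by (simp add: group_hom_def group_hom_axioms_def)
qed

text \<open>
  The saturated cycles form a subgroup, so their classes already form a subgroup of homology: to be
  generated by such classes means to consist of them.
\<close>
lemma diagonal_iff:
  "diagonal X d \<longleftrightarrow> (\<forall>k. \<forall>c \<in> cycles X d k. \<exists>c' \<in> cycles X d k.
     Poly_Mapping.keys c' \<subseteq> saturated_paths X d k \<and> c - c' \<in> boundaries X d k)"
proof -
  have "generate (MH X d k)
          (homology_class X d k ` {c \<in> cycles X d k. Poly_Mapping.keys c \<subseteq> saturated_paths X d k})
        = homology_class X d k ` {c \<in> cycles X d k. Poly_Mapping.keys c \<subseteq> saturated_paths X d k}"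
    (is "_ = _ ` ?S k") for k
  proof -
    interpret h: group_hom "cycle_group X d k" "MH X d k" "homology_class X d k"
      by (rule group_hom_homology_class)
    have "subgroup (homology_class X d k ` ?S k) (MH X d k)"
      by (rule h.subgroup_img_is_subgroup[OF subgroup_cycle_group_supported])
    then show ?thesis
      using h.H.generateI[of "homology_class X d k ` ?S k" "homology_class X d k ` ?S k"] by simp
  qed
  then have "diagonal X d \<longleftrightarrow> (\<forall>k. homology_class X d k `
      {c \<in> cycles X d k. Poly_Mapping.keys c \<subseteq> saturated_paths X d k}
      = homology_class X d k ` cycles X d k)"
    by (simp add: diagonal_def carrier_MH)
  also have "\<dots> \<longleftrightarrow> (\<forall>k. \<forall>c \<in> cycles X d k. \<exists>c' \<in> cycles X d k.
      Poly_Mapping.keys c' \<subseteq> saturated_paths X d k \<and>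
      homology_class X d k c = homology_class X d k c')"
    proof -
    have "h ` {c \<in> C. P c} = h ` C \<longleftrightarrow> (\<forall>c\<in>C. \<exists>c'\<in>C. P c' \<and> h c = h c')"
      for h :: "('a list \<Rightarrow>\<^sub>0 int) \<Rightarrow> ('a list \<Rightarrow>\<^sub>0 int) set" and C P
      by blast
    then show ?thesis
      by simp
  qed
  finally show ?thesis
    by (simp add: homology_class_eq_iff)
qed

section \<open>The saturated part of a chain\<close>

definition saturated_part ::
    "'a set \<Rightarrow> ('a \<Rightarrow> 'a \<Rightarrow> real) \<Rightarrow> nat \<Rightarrow> ('a list \<Rightarrow>\<^sub>0 int) \<Rightarrow> ('a list \<Rightarrow>\<^sub>0 int)"
  where "saturated_part X d k =
    frag_extend (\<lambda>xs. if xs \<in> saturated_paths X d k then frag_of xs else 0)"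

lemma saturated_part_ident:
  assumes "Poly_Mapping.keys c \<subseteq> saturated_paths X d k"
  shows "saturated_part X d k c = c"
proof -
  have "saturated_part X d k c = frag_extend frag_of c"
    unfolding saturated_part_def using assms by (intro frag_extend_eq) auto
  then show ?thesis
    by (simp add: frag_expansion[symmetric])
qed

lemma keys_saturated_part:
  "Poly_Mapping.keys (saturated_part X d k c) \<subseteq> saturated_paths X d k"
  unfolding saturated_part_def
  by (rule order_trans[OF keys_frag_extend]) (auto split: if_splits)

lemma delete_nth_not_saturated:
  assumes xs: "xs \<in> paths X (Suc k)" and i: "1 \<le> i" "i \<le> k"
    and btw: "is_between d (xs ! (i - 1)) (xs ! (i + 1)) (xs ! i)"
  shows "delete_nth i xs \<notin> saturated_paths X d k"
proof
  assume sat: "delete_nth i xs \<in> saturated_paths X d k"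
  have len: "length xs = Suc (Suc k)" and X: "set xs \<subseteq> X"
    and ne: "\<And>j. j \<le> k \<Longrightarrow> xs ! j \<noteq> xs ! Suc j"
    using xs by (auto simp: paths_def less_Suc_eq_le)
  have "delete_nth i xs ! (i - 1) = xs ! (i - 1)" "delete_nth i xs ! i = xs ! (i + 1)"
    using i len by (auto simp: delete_nth_def nth_append)
  moreover have "strictly_between X d (delete_nth i xs ! (i - 1)) (delete_nth i xs ! i) = {}"
    using sat i by (auto simp: saturated_paths_def dest: spec[of _ "i - 1"])
  ultimately have "xs ! i \<notin> strictly_between X d (xs ! (i - 1)) (xs ! (i + 1))"
    by simp
  moreover have "xs ! i \<in> X"
    using X len i by (simp add: subset_eq)
  moreover have "xs ! i \<noteq> xs ! (i - 1)" "xs ! i \<noteq> xs ! (i + 1)"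
  proof -
    have "i - 1 \<le> k" "Suc (i - 1) = i"
      using i by simp_all
    then show "xs ! i \<noteq> xs ! (i - 1)" "xs ! i \<noteq> xs ! (i + 1)"
      using ne[of "i - 1"] ne[of i] i(2) by auto
  qed
  ultimately show False
    using btw by (simp add: strictly_between_def)
qed

lemma saturated_part_boundary:
  assumes "b \<in> boundaries X d k"
  shows "saturated_part X d k b = 0"
proof -
  obtain e where e: "Poly_Mapping.keys e \<subseteq> paths X (Suc k)" and b: "b = boundary d (Suc k) e"
    using assms by (auto simp: boundaries_def carrier_MC)
  have "saturated_part X d k (boundary d (Suc k) e) = 0"
    using e
  proof (induction e rule: frag_induction)
    case zero
    show ?case by (simp add: saturated_part_def)
  next
    case (one xs)
    have "saturated_part X d k (face d i xs) = 0" if "i \<in> {1..k}" for i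
      using delete_nth_not_saturated[OF one, of i d] that
      by (auto simp: face_def saturated_part_def)
    then show ?case
      by (simp add: boundary_def saturated_part_def frag_extend_sum frag_extend_cmul)
  next
    case (diff a b)
    then show ?case
      by (simp add: boundary_def saturated_part_def frag_extend_diff)
  qed
  with b show ?thesis by simp
qed

text \<open>
  A saturated representative of a homology class is unique, because the projection onto saturated
  paths does not see boundaries; it can therefore be read off from any cycle of the class.
\<close>
lemma saturated_part_homologous:
  assumes "diagonal X d" and "c \<in> cycles X d k"
  shows "saturated_part X d k c \<in> cycles X d k"
    and "c - saturated_part X d k c \<in> boundaries X d k"
proof -
  obtain c' where c': "c' \<in> cycles X d k" "Poly_Mapping.keys c' \<subseteq> saturated_paths X d k"
    and bd: "c - c' \<in> boundaries X d k"
    using assms unfolding diagonal_iff by meson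
  have "saturated_part X d k c - saturated_part X d k c' = 0"
    using saturated_part_boundary[OF bd] by (simp add: saturated_part_def frag_extend_diff)
  then have "saturated_part X d k c = c'"
    using saturated_part_ident[OF c'(2)] by simp
  with c' bd show "saturated_part X d k c \<in> cycles X d k"
    and "c - saturated_part X d k c \<in> boundaries X d k"
    by simp_all
qed

section \<open>Filtrations\<close>

lemma filtration_finite_subset:
  assumes "filtration X A r U" and "finite F" and "F \<subseteq> X"
  shows "\<exists>\<alpha>\<in>A. F \<subseteq> U \<alpha>"
  using assms(2,3)
proof (induction F rule: finite_induct)
  case empty
  show ?case
    using assms(1) by (auto simp: filtration_def directed_set_def)
next
  case (insert x F)
  then obtain \<alpha> where \<alpha>: "\<alpha> \<in> A" "F \<subseteq> U \<alpha>"
    by auto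
  obtain \<beta> where \<beta>: "\<beta> \<in> A" "x \<in> U \<beta>"
    using assms(1) insert.prems by (auto simp: filtration_def)
  obtain \<gamma> where \<gamma>: "\<gamma> \<in> A" "(\<alpha>, \<gamma>) \<in> r" "(\<beta>, \<gamma>) \<in> r"
    using assms(1) \<alpha>(1) \<beta>(1) unfolding filtration_def directed_set_def by meson
  have "U \<alpha> \<subseteq> U \<gamma>" "U \<beta> \<subseteq> U \<gamma>"
    using assms(1) \<alpha>(1) \<beta>(1) \<gamma> unfolding filtration_def by meson+
  with \<alpha> \<beta> \<gamma> show ?case by blast
qed

text \<open>
  One intermediate point per unsaturated path suffices to make a subspace detect which of finitely
  many paths are saturated in the whole space.
\<close>
lemma finite_set_detecting_saturation:
  assumes "finite P" and "P \<subseteq> paths X k"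
  obtains F where "finite F" and "F \<subseteq> X"
    and "\<And>V. F \<subseteq> V \<Longrightarrow> V \<subseteq> X \<Longrightarrow>
      P \<subseteq> paths V k \<and> (\<forall>xs\<in>P. xs \<in> saturated_paths V d k \<longleftrightarrow> xs \<in> saturated_paths X d k)"
proof -
  have "\<forall>xs \<in> P - saturated_paths X d k.
      \<exists>z. \<exists>i<k. z \<in> strictly_between X d (xs ! i) (xs ! Suc i)"
    using assms(2) by (fastforce simp: saturated_paths_def)
  then obtain z where z: "\<And>xs. xs \<in> P - saturated_paths X d k \<Longrightarrow>
      \<exists>i<k. z xs \<in> strictly_between X d (xs ! i) (xs ! Suc i)"
    by metis
  define F where "F = (\<Union>xs\<in>P. set xs) \<union> z ` (P - saturated_paths X d k)"
  show thesis
  proof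
    show "finite F"
      using assms(1) by (simp add: F_def)
    show "F \<subseteq> X"
      using assms(2) z by (fastforce simp: F_def paths_def strictly_between_def)
  next
    fix V assume FV: "F \<subseteq> V" and VX: "V \<subseteq> X"
    have P: "P \<subseteq> paths V k"
      using assms(2) FV by (fastforce simp: F_def paths_def)
    have "xs \<in> saturated_paths X d k" if "xs \<in> P" "xs \<in> saturated_paths V d k" for xs
    proof (rule ccontr)
      assume "xs \<notin> saturated_paths X d k"
      then obtain i where i: "i < k" "z xs \<in> strictly_between X d (xs ! i) (xs ! Suc i)"
        using z \<open>xs \<in> P\<close> by blast
      moreover have "z xs \<in> V"
        using FV \<open>xs \<in> P\<close> \<open>xs \<notin> saturated_paths X d k\<close> by (auto simp: F_def)
      ultimately show False
        using that(2) by (auto simp: saturated_paths_def strictly_between_def)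
    qed
    moreover have "xs \<in> saturated_paths V d k" if "xs \<in> P" "xs \<in> saturated_paths X d k" for xs
      using that P VX by (fastforce simp: saturated_paths_def strictly_between_def)
    ultimately show "P \<subseteq> paths V k \<and>
        (\<forall>xs\<in>P. xs \<in> saturated_paths V d k \<longleftrightarrow> xs \<in> saturated_paths X d k)"
      using P by blast
  qed
qed

theorem proposition4p7:
  fixes X :: "'a set" and d :: "'a \<Rightarrow> 'a \<Rightarrow> real"
    and A :: "'i set" and r :: "('i \<times> 'i) set" and U :: "'i \<Rightarrow> 'a set"
  assumes "Metric_space X d"
    and "filtration X A r U"
    and "\<And>\<alpha>. \<alpha> \<in> A \<Longrightarrow> diagonal (U \<alpha>) d"
  shows "diagonal X d"
  unfolding diagonal_iff
proof (intro allI ballI)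
  fix k c assume c: "c \<in> cycles X d k"
  then have "Poly_Mapping.keys c \<subseteq> paths X k"
    by (simp add: cycles_iff)
  then obtain F where "finite F" "F \<subseteq> X"
    and F: "\<And>V. F \<subseteq> V \<Longrightarrow> V \<subseteq> X \<Longrightarrow> Poly_Mapping.keys c \<subseteq> paths V k \<and>
      (\<forall>xs\<in>Poly_Mapping.keys c. xs \<in> saturated_paths V d k \<longleftrightarrow> xs \<in> saturated_paths X d k)"
    using finite_set_detecting_saturation[OF finite_keys, of c X k d] by blast
  then obtain \<alpha> where \<alpha>: "\<alpha> \<in> A" "F \<subseteq> U \<alpha>"
    using filtration_finite_subset[OF assms(2)] by blast
  have UX: "U \<alpha> \<subseteq> X"
    using assms(2) \<alpha>(1) by (auto simp: filtration_def)
  have cU: "c \<in> cycles (U \<alpha>) d k"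
    using c F[OF \<alpha>(2) UX] by (simp add: cycles_iff)
  have same: "saturated_part (U \<alpha>) d k c = saturated_part X d k c"
    unfolding saturated_part_def using F[OF \<alpha>(2) UX] by (intro frag_extend_eq) auto
  have "saturated_part X d k c \<in> cycles X d k"
    using saturated_part_homologous(1)[OF assms(3)[OF \<alpha>(1)] cU] paths_mono[OF UX, of k]
    by (auto simp: same cycles_iff)
  moreover have "c - saturated_part X d k c \<in> boundaries X d k"
    using saturated_part_homologous(2)[OF assms(3)[OF \<alpha>(1)] cU] boundaries_mono[OF UX]
    by (auto simp: same)
  ultimately show "\<exists>c' \<in> cycles X d k. Poly_Mapping.keys c' \<subseteq> saturated_paths X d k \<and>
      c - c' \<in> boundaries X d k"
    using keys_saturated_part by blast
qed

end
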